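(* Let $\mathcal{T}$ be a locally finite, vertex-to-vertex parallelogram tiling of $\mathbb{R}^2$. Two distinct worms of $\mathcal{T}$ cross at most once, and distinct worms in the same worm family never cross. In other words: the intersection of any two distinct worms is empty or consists of a single tile, and the intersection of two different worms defined by parallel edges is empty.
   Context: A parallelogram tiling is a countable collection $\mathcal{T}=\{T_1,T_2,\ldots\}$ of non-degenerate (nonempty interior) closed parallelograms in $\mathbb{R}^2$, called tiles, with $\bigcup_i T_i=\mathbb{R}^2$ and $\operatorname{int}(T_i)\cap\operatorname{int}(T_j)=\varnothing$ for $i\neq j$. It is locally finite if each ball in $\mathbb{R}^2$ intersects only finitely many tiles. It is vertex-to-vertex if, whenever $x\in\mathbb{R}^2$ is a vertex of some tile $T\in\mathcal{T}$ and $x\in T'\in\mathcal{T}$, then $x$ is a vertex of $T'$. Worms: let $T$ be a tile and $e$ one of its edges. There is a unique tile $T_1\neq T$ sharing the edge $e$ with $T$. Let $e_1\neq e$ be the edge of $T_1$ parallel to $e$; there is a unique tile $T_2\neq T_1$ sharing $e_1$ with $T_1$. Repeating this gives a one-sided infinite sequence $T,T_1,T_2,\ldots$; doing the same starting from the edge of $T$ opposite to $e$ gives $T_{-1},T_{-2},\ldots$. The biinfinite sequence $\ldots,T_{-2},T_{-1},T,T_1,T_2,\ldots$ is called the worm given by $T$ and $e$; any such sequence is called a worm. Worms are identified if they differ only by an index shift and/or reversal. The intersection of two worms $W,W'$ is $W\cap W'=\{T : T\in W,\ T\in W'\}$, a set of tiles. The worm family given by an edge $e$ of the tiling is the set of all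 worms which are defined by edges parallel to $e$. *)

theory Defs
  imports "HOL-Analysis.Analysis"
begin

definition parallelogram :: "(real^2) set \<Rightarrow> bool" where
  "parallelogram P \<longleftrightarrow>
     (\<exists>a u v. P = convex hull {a, a + u, a + u + v, a + v}) \<and> interior P \<noteq> {}"

text \<open>
  A tiling is given as a set of tiles instead of an indexed collection: tiles have nonempty
  interior, so disjointness of interiors already rules out repetitions in an indexing.
\<close>

definition parallelogram_tiling :: "(real^2) set set \<Rightarrow> bool" where
  "parallelogram_tiling \<T> \<longleftrightarrow>
     countable \<T> \<and> (\<forall>T\<in>\<T>. parallelogram T) \<and> \<Union>\<T> = UNIV \<and>
     (\<forall>T\<in>\<T>. \<forall>T'\<in>\<T>. T \<noteq> T' \<longrightarrow> interior T \<inter> interior T' = {})"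

definition locally_finite_tiling :: "(real^2) set set \<Rightarrow> bool" where
  "locally_finite_tiling \<T> \<longleftrightarrow> (\<forall>x r. finite {T \<in> \<T>. T \<inter> ball x r \<noteq> {}})"

text \<open>
  Vertices and edges of a tile are its extreme points and its one-dimensional faces.
\<close>

definition vertex_to_vertex :: "(real^2) set set \<Rightarrow> bool" where
  "vertex_to_vertex \<T> \<longleftrightarrow>
     (\<forall>T\<in>\<T>. \<forall>T'\<in>\<T>. \<forall>x. x extreme_point_of T \<and> x \<in> T' \<longrightarrow> x extreme_point_of T')"

definition parallel_edges :: "(real^2) set \<Rightarrow> (real^2) set \<Rightarrow> bool" where
  "parallel_edges e e' \<longleftrightarrow> affine_parallel (affine hull e) (affine hull e')"

text \<open>
  \<open>worm_from \<T> T e W\<close>: the biinfinite sequence \<open>W\<close> is the worm given by the tile \<open>T\<close> and its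
  edge \<open>e\<close>. Here \<open>E i\<close> is the edge shared by \<open>W i\<close> and \<open>W (i + 1)\<close>, with \<open>E 0 = e\<close>; thus
  \<open>E (- 1)\<close> is the edge of \<open>T\<close> opposite to \<open>e\<close>, through which the sequence continues to
  \<open>W (- 1)\<close>.
\<close>

definition worm_from ::
  "(real^2) set set \<Rightarrow> (real^2) set \<Rightarrow> (real^2) set \<Rightarrow> (int \<Rightarrow> (real^2) set) \<Rightarrow> bool" where
  "worm_from \<T> T e W \<longleftrightarrow>
     W 0 = T \<and>
     (\<exists>E. E 0 = e \<and>
       (\<forall>i. W i \<in> \<T> \<and> W (i + 1) \<noteq> W i \<and>
            E i edge_of W i \<and> E i edge_of W (i + 1) \<and>
            E (i + 1) \<noteq> E i \<and> parallel_edges (E i) (E (i + 1))))"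

definition worm :: "(real^2) set set \<Rightarrow> (int \<Rightarrow> (real^2) set) \<Rightarrow> bool" where
  "worm \<T> W \<longleftrightarrow> (\<exists>T\<in>\<T>. \<exists>e. e edge_of T \<and> worm_from \<T> T e W)"

text \<open>Worms are identified up to an index shift and/or reversal.\<close>

definition same_worm :: "(int \<Rightarrow> (real^2) set) \<Rightarrow> (int \<Rightarrow> (real^2) set) \<Rightarrow> bool" where
  "same_worm W W' \<longleftrightarrow> (\<exists>k. (\<forall>i. W' i = W (i + k)) \<or> (\<forall>i. W' i = W (k - i)))"

definition worm_inter ::
  "(int \<Rightarrow> (real^2) set) \<Rightarrow> (int \<Rightarrow> (real^2) set) \<Rightarrow> (real^2) set set" where
  "worm_inter W W' = {T. T \<in> range W \<and> T \<in> range W'}"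

definition worm_family ::
  "(real^2) set set \<Rightarrow> (real^2) set \<Rightarrow> (int \<Rightarrow> (real^2) set) set" where
  "worm_family \<T> e =
     {W. \<exists>T\<in>\<T>. \<exists>e'. e' edge_of T \<and> parallel_edges e e' \<and> worm_from \<T> T e' W}"

end

(*
  Let u be the edge vector of a worm W. Send a point of a tile of W to cis (2 * pi * s), where s
  is its coordinate in direction u, and every other point of the plane to 1. In a vertex-to-vertex
  tiling this is a continuous map from the plane to the circle, so it has a continuous real
  logarithm F. This F is constant on each tile outside W, constant along either boundary line
  of W, and grows by 1 when W is crossed in direction u. All tiles of a second worm W' lie on the
  same side of their entry edge, so W' crosses W always in the same direction, and F is monotone
  along W'. It would have to return to its old value before a second crossing, which is impossible.
  Worms with parallel edges that share a tile coincide, since neighbours are unique.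
*)

theory Submission
  imports Defs
begin

section \<open>Parallelograms and their sides\<close>

text \<open>A worm is not known in advance to be simple: a tile might recur in it, so one cannot
  start from two sides that it leaves in the plane. The height F replaces such sides. It needs only
  that the coordinates of touching tiles agree modulo 1. A point common to two tiles is either a
  vertex, where the coordinate is an integer, or lies on a full common edge; this is what
  vertex-to-vertex provides. At an edge that W passes through, both tiles give the same coordinate.
  Any other edge of a tile of W lies along the boundary of W, where the coordinate is 0 or 1. F
  takes one fixed value at every entry of a crossing and one more at every exit, so two crossing
  positions of the second worm contradict monotonicity even if they carry the same tile.\<close>

definition cross2 :: "real^2 \<Rightarrow> real^2 \<Rightarrow> real" where
  "cross2 x y = x $ 1 * y $ 2 - x $ 2 * y $ 1"

lemma cross2_simps [simp]:
  "cross2 (x + y) z = cross2 x z + cross2 y z"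
  "cross2 x (y + z) = cross2 x y + cross2 x z"
  "cross2 (x - y) z = cross2 x z - cross2 y z"
  "cross2 x (y - z) = cross2 x y - cross2 x z"
  "cross2 (- x) z = - cross2 x z"
  "cross2 x (- z) = - cross2 x z"
  "cross2 (c *\<^sub>R x) z = c * cross2 x z"
  "cross2 x (c *\<^sub>R z) = c * cross2 x z"
  "cross2 x x = 0"
  "cross2 0 x = 0"
  "cross2 x 0 = 0"
  by (simp_all add: cross2_def algebra_simps)

lemma cross2_commute: "cross2 x y = - cross2 y x"
  by (simp add: cross2_def)

text \<open>Cramer's rule. The coefficient of \<open>u\<close> is the formula from which the
  transverse coordinate of a worm is built later.\<close>

lemma cross2_basis:
  assumes "cross2 u v \<noteq> 0"
  shows "x = (cross2 x v / cross2 u v) *\<^sub>R u + (cross2 u x / cross2 u v) *\<^sub>R v"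
proof -
  have "cross2 u v *\<^sub>R x = cross2 x v *\<^sub>R u + cross2 u x *\<^sub>R v"
    by (simp add: cross2_def vec_eq_iff forall_2 algebra_simps)
  then have "x = (1 / cross2 u v) *\<^sub>R (cross2 x v *\<^sub>R u + cross2 u x *\<^sub>R v)"
    using assms by (simp add: eq_vector_fraction_iff)
  then show ?thesis
    by (simp add: scaleR_add_right)
qed

lemma cross2_eq_0_iff:
  assumes "u \<noteq> 0"
  shows "cross2 u x = 0 \<longleftrightarrow> (\<exists>c. x = c *\<^sub>R u)"
proof
  assume *: "cross2 u x = 0"
  have "u $ 1 \<noteq> 0 \<or> u $ 2 \<noteq> 0"
    using assms by (simp add: vec_eq_iff forall_2)
  then show "\<exists>c. x = c *\<^sub>R u"
  proof
    assume "u $ 1 \<noteq> 0"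
    with * have "x = (x $ 1 / u $ 1) *\<^sub>R u"
      by (simp add: cross2_def vec_eq_iff forall_2 field_simps)
    then show ?thesis ..
  next
    assume "u $ 2 \<noteq> 0"
    with * have "x = (x $ 2 / u $ 2) *\<^sub>R u"
      by (simp add: cross2_def vec_eq_iff forall_2 field_simps)
    then show ?thesis ..
  qed
qed auto

lemma cross2_eq_0_trans:
  assumes "u \<noteq> 0" "cross2 u x = 0" "cross2 u y = 0"
  shows "cross2 x y = 0"
  using assms by (auto simp: cross2_eq_0_iff)

lemma continuous_on_cross2 [continuous_intros]:
  assumes "continuous_on S f" "continuous_on S g"
  shows "continuous_on S (\<lambda>x. cross2 (f x) (g x))"
  unfolding cross2_def by (intro continuous_intros assms)

text \<open>Explicit parameters give coordinates to compute with. A nondegenerate parallelogram has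
  eight such descriptions (a corner and an order of the two edge vectors); swapping and flipping
  moves between them.\<close>

definition para :: "real^2 \<Rightarrow> real^2 \<Rightarrow> real^2 \<Rightarrow> (real^2) set" where
  "para a u v = {a + s *\<^sub>R u + t *\<^sub>R v | s t. 0 \<le> s \<and> s \<le> 1 \<and> 0 \<le> t \<and> t \<le> 1}"

definition side :: "real^2 \<Rightarrow> real^2 \<Rightarrow> (real^2) set" where
  "side a u = closed_segment a (a + u)"

lemma paraI: "0 \<le> s \<Longrightarrow> s \<le> 1 \<Longrightarrow> 0 \<le> t \<Longrightarrow> t \<le> 1 \<Longrightarrow> a + s *\<^sub>R u + t *\<^sub>R v \<in> para a u v"
  by (auto simp: para_def)

lemma para_swap: "para a u v = para a v u"
  unfolding para_def by (auto; metis add.assoc add.commute)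

lemma para_flip1: "para (a + u) (- u) v = para a u v"
proof -
  have *: "para (a + u) (- u) v \<subseteq> para a u v" for a u v :: "real^2"
  proof
    fix x assume "x \<in> para (a + u) (- u) v"
    then obtain s t where st: "0 \<le> s" "s \<le> 1" "0 \<le> t" "t \<le> 1"
      and x: "x = a + u + s *\<^sub>R (- u) + t *\<^sub>R v"
      by (auto simp: para_def)
    have "x = a + (1 - s) *\<^sub>R u + t *\<^sub>R v"
      using x by (simp add: algebra_simps)
    then show "x \<in> para a u v"
      using st paraI[of "1 - s" t a u v] by simp
  qed
  show ?thesis
    using *[of a u v] *[of "a + u" "- u" v] by simp
qed

lemma para_flip2: "para (a + v) u (- v) = para a u v"
  by (metis para_flip1 para_swap)

lemma side_flip: "side (a + u) (- u) = side a u"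
  by (simp add: side_def closed_segment_commute)

lemma mem_side: "x \<in> side a u \<longleftrightarrow> (\<exists>s. 0 \<le> s \<and> s \<le> 1 \<and> x = a + s *\<^sub>R u)"
  by (auto simp: side_def in_segment algebra_simps)

lemma side_eq_iff: "side a u = side b w \<longleftrightarrow> a = b \<and> u = w \<or> b = a + u \<and> w = - u"
proof -
  have "a = b + w \<and> a + u = b \<longleftrightarrow> b = a + u \<and> w = - u"
    by (auto simp: vec_eq_iff forall_2)
  then show ?thesis
    unfolding side_def closed_segment_eq doubleton_eq_iff by auto
qed

text \<open>The reversed reading of a segment would need \<open>u = - u\<close>, hence
  \<open>u = 0\<close>, and then the base points agree anyway.\<close>

lemma side_eq_same_vector:
  assumes "side a u = side b u"
  shows "a = b"
proof -
  have "u = 0" if "u = - u"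
    using that by (simp add: vec_eq_iff)
  then show ?thesis
    using assms by (auto simp: side_eq_iff)
qed

lemma convex_hull_para: "convex hull {a, a + u, a + u + v, a + v} = para a u v" (is "?H = _")
proof
  have "convex (para a u v)"
  proof (rule convexI)
    fix x y and c d :: real
    assume x: "x \<in> para a u v" and y: "y \<in> para a u v" and cd: "0 \<le> c" "0 \<le> d" "c + d = 1"
    from x obtain s t where st: "0 \<le> s" "s \<le> 1" "0 \<le> t" "t \<le> 1" "x = a + s *\<^sub>R u + t *\<^sub>R v"
      by (auto simp: para_def)
    from y obtain s' t' where st': "0 \<le> s'" "s' \<le> 1" "0 \<le> t'" "t' \<le> 1" "y = a + s' *\<^sub>R u + t' *\<^sub>R v"
      by (auto simp: para_def)
    have "c *\<^sub>R x + d *\<^sub>R y = (c + d) *\<^sub>R a + (c * s + d * s') *\<^sub>R u + (c * t + d * t') *\<^sub>R v"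
      using st st' by (simp add: algebra_simps)
    moreover have "c * s + d * s' \<le> 1" "c * t + d * t' \<le> 1"
      using st st' cd convex_bound_le by blast+
    ultimately show "c *\<^sub>R x + d *\<^sub>R y \<in> para a u v"
      using st st' cd paraI[of "c * s + d * s'" "c * t + d * t'" a u v] by simp
  qed
  moreover have "{a, a + u, a + u + v, a + v} \<subseteq> para a u v"
    using paraI[of 0 0 a u v] paraI[of 1 0 a u v] paraI[of 1 1 a u v] paraI[of 0 1 a u v] by simp
  ultimately show "?H \<subseteq> para a u v"
    by (simp add: hull_minimal)
next
  show "para a u v \<subseteq> ?H"
  proof
    fix x assume "x \<in> para a u v"
    then obtain s t where st: "0 \<le> s" "s \<le> 1" "0 \<le> t" "t \<le> 1" "x = a + s *\<^sub>R u + t *\<^sub>R v"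
      by (auto simp: para_def)
    have c: "convex ?H" by simp
    have m: "a \<in> ?H" "a + u \<in> ?H" "a + u + v \<in> ?H" "a + v \<in> ?H"
      by (auto intro: hull_inc)
    \<comment> \<open>Interpolate along two opposite sides first, then between the two points
      found.\<close>
    have "(1 - s) *\<^sub>R a + s *\<^sub>R (a + u) \<in> ?H" "(1 - s) *\<^sub>R (a + v) + s *\<^sub>R (a + u + v) \<in> ?H"
      using convexD[OF c m(1,2), of "1 - s" s] convexD[OF c m(4,3), of "1 - s" s] st by auto
    then have "(1 - t) *\<^sub>R ((1 - s) *\<^sub>R a + s *\<^sub>R (a + u)) + t *\<^sub>R ((1 - s) *\<^sub>R (a + v) + s *\<^sub>R (a + u + v)) \<in> ?H"
      using convexD[OF c, of _ _ "1 - t" t] st by auto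
    then show "x \<in> ?H"
      using st by (simp add: algebra_simps)
  qed
qed

lemma convex_para: "convex (para a u v)"
  unfolding convex_hull_para[symmetric] by (rule convex_convex_hull)

lemma compact_para: "compact (para a u v)"
  unfolding convex_hull_para[symmetric] by (rule finite_imp_compact_convex_hull) simp

lemma closed_para: "closed (para a u v)"
  by (simp add: compact_para compact_imp_closed)

text \<open>The Cramer coordinates are continuous, so keeping both strictly between 0 and 1 defines
  an open subset of the parallelogram.\<close>

lemma interior_para:
  assumes "cross2 u v \<noteq> 0" "0 < s" "s < 1" "0 < t" "t < 1"
  shows "a + s *\<^sub>R u + t *\<^sub>R v \<in> interior (para a u v)"
proof (rule interiorI)
  let ?f = "\<lambda>x. cross2 (x - a) v / cross2 u v" and ?g = "\<lambda>x. cross2 u (x - a) / cross2 u v"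
  let ?O = "{x. 0 < ?f x \<and> ?f x < 1 \<and> 0 < ?g x \<and> ?g x < 1}"
  show "open ?O"
    by (intro open_Collect_conj open_Collect_less continuous_intros) (use assms in auto)
  show "a + s *\<^sub>R u + t *\<^sub>R v \<in> ?O"
    using assms by simp
  show "?O \<subseteq> para a u v"
  proof
    fix x assume "x \<in> ?O"
    then show "x \<in> para a u v"
      using cross2_basis[OF assms(1), of "x - a"] paraI[of "?f x" "?g x" a u v]
      by (simp add: algebra_simps)
  qed
qed

lemma parallelogramE:
  assumes "parallelogram T"
  obtains a u v where "T = para a u v" "cross2 u v \<noteq> 0"
proof -
  from assms obtain a u v where T: "T = para a u v" and ne: "interior T \<noteq> {}"
    unfolding parallelogram_def convex_hull_para by blast
  have "cross2 u v \<noteq> 0"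
  proof
    assume 0: "cross2 u v = 0"
    \<comment> \<open>A common direction of \<open>u\<close> and \<open>v\<close>: the degenerate
      parallelogram lies on a line in direction \<open>d\<close>.\<close>
    obtain d where d: "d \<noteq> 0" "cross2 d u = 0" "cross2 d v = 0"
    proof (cases "u = 0")
      case True
      show ?thesis
      proof (cases "v = 0")
        case True
        with \<open>u = 0\<close> that[of "axis 1 1"] show ?thesis by (simp add: axis_eq_0_iff)
      next
        case False
        with \<open>u = 0\<close> that[of v] show ?thesis by simp
      qed
    next
      case False
      with 0 that[of u] show ?thesis by simp
    qed
    \<comment> \<open>The quarter turn of \<open>d\<close>, so that the line becomes a hyperplane
      with normal \<open>n\<close>.\<close>
    define n :: "real^2" where "n = vector [- d $ 2, d $ 1]"
    have n: "n \<bullet> x = cross2 d x" for x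
      by (simp add: n_def cross2_def inner_vec_def sum_2)
    have "n \<noteq> 0"
      using d(1) by (auto simp: n_def vec_eq_iff forall_2)
    then have "interior {x. n \<bullet> x = n \<bullet> a} = {}"
      by (rule interior_hyperplane)
    moreover have "T \<subseteq> {x. n \<bullet> x = n \<bullet> a}"
      using d by (auto simp: T para_def n)
    ultimately show False
      using ne interior_mono by blast
  qed
  with T that show ?thesis by blast
qed

section \<open>Faces of a parallelogram: its edges are its four sides, its vertices the
  corners\<close>

lemma side_face_of_para:
  assumes "cross2 u v \<noteq> 0"
  shows "side a u face_of para a u v"
  unfolding face_of_def
proof (intro conjI ballI impI)
  show "side a u \<subseteq> para a u v"
    using paraI[of _ 0 a u v] by (auto simp: mem_side)
  show "convex (side a u)"
    by (simp add: side_def)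
next
  fix b c x assume b: "b \<in> para a u v" and c: "c \<in> para a u v"
    and x: "x \<in> side a u" and seg: "x \<in> open_segment b c"
  from b obtain s t where st: "0 \<le> s" "s \<le> 1" "0 \<le> t" "t \<le> 1" "b = a + s *\<^sub>R u + t *\<^sub>R v"
    by (auto simp: para_def)
  from c obtain s' t' where st': "0 \<le> s'" "s' \<le> 1" "0 \<le> t'" "t' \<le> 1" "c = a + s' *\<^sub>R u + t' *\<^sub>R v"
    by (auto simp: para_def)
  from x obtain r where r: "x = a + r *\<^sub>R u"
    by (auto simp: mem_side)
  from seg obtain l where l: "0 < l" "l < 1" "x = (1 - l) *\<^sub>R b + l *\<^sub>R c"
    by (auto simp: in_segment)
  have "x - a = (1 - l) *\<^sub>R (b - a) + l *\<^sub>R (c - a)"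
    using l by (simp add: algebra_simps)
  \<comment> \<open>Up to a constant factor, \<open>cross2 u\<close> reads off the coordinate along
    \<open>v\<close>, which vanishes on the side and is nonnegative at \<open>b\<close> and
    \<open>c\<close>.\<close>
  then have "cross2 u (x - a) = (1 - l) * cross2 u (b - a) + l * cross2 u (c - a)"
    by simp
  then have "((1 - l) * t + l * t') * cross2 u v = 0"
    by (simp add: r st st' algebra_simps)
  with assms have eq: "(1 - l) * t + l * t' = 0"
    by simp
  have "(1 - l) * t \<ge> 0" "l * t' \<ge> 0"
    using l st st' by simp_all
  with eq have "(1 - l) * t = 0" "l * t' = 0"
    by linarith+
  then have "t = 0" "t' = 0"
    using l by simp_all
  then show "b \<in> side a u" "c \<in> side a u"
    using st st' by (auto simp: mem_side)
qed

lemma side_edge_of_para: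
  assumes "cross2 u v \<noteq> 0"
  shows "side a u edge_of para a u v"
proof -
  have "u \<noteq> 0" using assms by auto
  then have "aff_dim (side a u) = 1"
    by (simp add: side_def segment_convex_hull aff_dim_convex_hull aff_dim_2)
  then show ?thesis
    using side_face_of_para[OF assms] by (simp add: edge_of_def)
qed

text \<open>Two faces meet in a face, and two adjacent sides meet in their common corner
  only.\<close>

lemma corner_extreme_point_of_para:
  assumes "cross2 u v \<noteq> 0"
  shows "a extreme_point_of para a u v"
proof -
  have vu: "cross2 v u \<noteq> 0"
    using assms cross2_commute[of v u] by simp
  have "side a u \<inter> side a v = {a}"
  proof (intro equalityI subsetI)
    fix x assume "x \<in> side a u \<inter> side a v"
    then obtain s t where "x = a + s *\<^sub>R u" "x = a + t *\<^sub>R v"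
      unfolding mem_side Int_iff by blast
    then have "s *\<^sub>R u = t *\<^sub>R v" by simp
    then have "s * cross2 u v = 0"
      using cross2_simps(7)[of s u v] by simp
    with assms \<open>x = a + s *\<^sub>R u\<close> show "x \<in> {a}" by simp
  qed (simp add: side_def)
  moreover have "(side a u \<inter> side a v) face_of para a u v"
    using side_face_of_para[OF assms, of a] side_face_of_para[OF vu, of a]
    by (metis face_of_Int para_swap)
  ultimately show ?thesis
    by (simp add: face_of_singleton)
qed

lemma side_endpoints_extreme:
  assumes "cross2 u v \<noteq> 0"
  shows "a extreme_point_of para a u v" "(a + u) extreme_point_of para a u v"
proof -
  show "a extreme_point_of para a u v"
    by (rule corner_extreme_point_of_para[OF assms])
  have "cross2 (- u) v \<noteq> 0" using assms by simp
  from corner_extreme_point_of_para[OF this, of "a + u"]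
  show "(a + u) extreme_point_of para a u v"
    unfolding para_flip1 .
qed

text \<open>One representation \<open>para P q w\<close> of \<open>para a u v\<close> for each of its sides \<open>side P q\<close>.\<close>

definition side_reps :: "real^2 \<Rightarrow> real^2 \<Rightarrow> real^2 \<Rightarrow> ((real^2) \<times> (real^2) \<times> (real^2)) set" where
  "side_reps a u v = {(a, u, v), (a + v, u, - v), (a, v, u), (a + u, v, - u)}"

lemma side_reps_para:
  assumes "(P, q, w) \<in> side_reps a u v" "cross2 u v \<noteq> 0"
  shows "para P q w = para a u v" "cross2 q w \<noteq> 0"
proof -
  have "para a v u = para a u v" "para (a + u) v (- u) = para a u v"
    by (metis para_flip2 para_swap)+
  moreover have "cross2 v u = - cross2 u v"
    by (rule cross2_commute)
  ultimately show "para P q w = para a u v" "cross2 q w \<noteq> 0"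
    using assms para_flip2[of a v u] unfolding side_reps_def by auto
qed

lemma para_boundaryE:
  assumes nz: "cross2 u v \<noteq> 0" and x: "x \<in> para a u v" "x \<notin> interior (para a u v)"
    "\<not> x extreme_point_of para a u v"
  obtains P q w s where "(P, q, w) \<in> side_reps a u v" "0 < s" "s < 1" "x = P + s *\<^sub>R q"
proof -
  from x obtain s t where st: "0 \<le> s" "s \<le> 1" "0 \<le> t" "t \<le> 1" "x = a + s *\<^sub>R u + t *\<^sub>R v"
    by (auto simp: para_def)
  have "(a + v) extreme_point_of para a u v" "(a + v + u) extreme_point_of para a u v"
    using side_endpoints_extreme[of u "- v" "a + v"] nz by (simp_all add: para_flip2)
  then have nc: "x \<notin> {a, a + u, a + v, a + v + u}"
    using x(3) side_endpoints_extreme[OF nz, of a] by auto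
  have "s = 0 \<or> s = 1 \<or> t = 0 \<or> t = 1"
    using interior_para[OF nz, of s t a] st x(2) by force
  then consider "t = 0" | "t = 1" | "s = 0" | "s = 1" by blast
  then show ?thesis
  proof cases
    case 1
    with nc st have "0 < s" "s < 1" by (auto simp: less_le)
    with 1 st that[of a u v s] show ?thesis by (simp add: side_reps_def)
  next
    case 2
    with nc st have "0 < s" "s < 1" by (auto simp: less_le algebra_simps)
    with 2 st that[of "a + v" u "- v" s] show ?thesis by (simp add: side_reps_def algebra_simps)
  next
    case 3
    with nc st have "0 < t" "t < 1" by (auto simp: less_le)
    with 3 st that[of a v u t] show ?thesis by (simp add: side_reps_def)
  next
    case 4
    with nc st have "0 < t" "t < 1" by (auto simp: less_le algebra_simps)
    with 4 st that[of "a + u" v "- u" t] show ?thesis by (simp add: side_reps_def algebra_simps)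
  qed
qed

text \<open>The midpoint of two distinct points of the edge is neither interior nor a vertex, hence
  lies strictly inside some side. The face property draws that whole side into the edge, and
  convexity leaves no room for more.\<close>

lemma edge_of_para_cases:
  assumes nz: "cross2 u v \<noteq> 0" and e: "e edge_of para a u v"
  obtains P q w where "(P, q, w) \<in> side_reps a u v" "e = side P q"
proof -
  let ?T = "para a u v"
  have face: "e face_of ?T" and dim: "aff_dim e = 1"
    using e by (auto simp: edge_of_def)
  have sub: "e \<subseteq> ?T" and conv: "convex e"
    using face face_of_imp_subset face_of_imp_convex by blast+
  have "a + (1/2) *\<^sub>R u + (1/2) *\<^sub>R v \<in> interior ?T"
    using interior_para[OF nz, of "1/2" "1/2" a] by simp
  then have "aff_dim ?T = 2"
    using aff_dim_nonempty_interior[of ?T] by auto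
  then have "e \<noteq> ?T" using dim by auto
  then have disj: "e \<inter> interior ?T = {}"
    using face face_of_disjoint_interior by blast
  have "\<exists>x\<in>e. \<exists>y\<in>e. x \<noteq> y"
  proof (rule ccontr)
    assume "\<not> ?thesis"
    then have "e = {} \<or> (\<exists>x. e = {x})" by blast
    with dim show False by auto
  qed
  then obtain x y where xy: "x \<in> e" "y \<in> e" "x \<noteq> y" by blast
  define z where "z = midpoint x y"
  have seg: "z \<in> open_segment x y"
    using xy(3) by (simp add: z_def)
  then have "z \<in> e"
    using xy conv convex_contains_open_segment by blast
  moreover have "\<not> z extreme_point_of ?T"
    using seg xy sub by (auto simp: extreme_point_of_def)
  ultimately obtain P q w s where rep: "(P, q, w) \<in> side_reps a u v"
    and s: "0 < s" "s < 1" and z: "z = P + s *\<^sub>R q"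
    using para_boundaryE[OF nz] sub disj by blast
  note T = side_reps_para[OF rep nz]
  have "q \<noteq> 0" using T(2) by auto
  have "P \<in> e \<and> P + q \<in> e"
  proof -
    have "P \<in> ?T" "P + q \<in> ?T"
      using side_endpoints_extreme[OF T(2), of P] T(1) by (auto simp: extreme_point_of_def)
    moreover have "z = (1 - s) *\<^sub>R P + s *\<^sub>R (P + q)"
      by (simp add: z algebra_simps)
    then have "z \<in> open_segment P (P + q)"
      using s \<open>q \<noteq> 0\<close> unfolding in_segment by auto
    ultimately show ?thesis
      using face \<open>z \<in> e\<close> unfolding face_of_def by blast
  qed
  then have "side P q \<subseteq> e"
    using conv by (simp add: side_def closed_segment_subset)
  moreover have "e \<subseteq> side P q"
  proof
    fix y assume y: "y \<in> e"
    then have "y \<in> para P q w" using sub T(1) by blast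
    then obtain s' t' where st': "0 \<le> s'" "s' \<le> 1" "0 \<le> t'" "t' \<le> 1" "y = P + s' *\<^sub>R q + t' *\<^sub>R w"
      by (auto simp: para_def)
    \<comment> \<open>A point of the edge off this side would, averaged with \<open>z\<close>, give
      an interior point of the parallelogram in the edge.\<close>
    have "t' = 0"
    proof (rule ccontr)
      assume "t' \<noteq> 0"
      then have "midpoint z y \<in> interior (para P q w)"
      proof -
        have "midpoint z y = P + ((s + s') / 2) *\<^sub>R q + (t' / 2) *\<^sub>R w"
          by (simp add: midpoint_def z st'(5) vec_eq_iff field_simps)
        then show ?thesis
          using interior_para[OF T(2), of "(s + s') / 2" "t' / 2" P] s st' \<open>t' \<noteq> 0\<close> by simp
      qed
      moreover have "midpoint z y \<in> e"
        using convexD[OF conv \<open>z \<in> e\<close> y, of "1/2" "1/2"] by (simp add: midpoint_def algebra_simps)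
      ultimately show False
        using disj T(1) by auto
    qed
    then show "y \<in> side P q"
      using st' by (auto simp: mem_side)
  qed
  ultimately show ?thesis
    using that rep by blast
qed

lemma parallel_edges_side:
  assumes "parallel_edges (side a u) (side b w)"
  shows "cross2 u w = 0"
proof -
  have hull: "affine hull (side a u) = affine hull {a, a + u}" for a u
    by (simp add: side_def segment_convex_hull)
  obtain c where c: "affine hull {b, b + w} = (\<lambda>x. c + x) ` (affine hull {a, a + u})"
    using assms unfolding parallel_edges_def affine_parallel_def hull by blast
  have pt: "\<exists>k. x = c + a + k *\<^sub>R u" if "x \<in> affine hull {b, b + w}" for x
  proof -
    from that have "x \<in> (\<lambda>x. c + x) ` (affine hull {a, a + u})"
      by (simp only: c)
    then obtain l k where "l + k = 1" "x = c + (l *\<^sub>R a + k *\<^sub>R (a + u))"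
      unfolding affine_hull_2 by blast
    moreover have "l *\<^sub>R a + k *\<^sub>R (a + u) = (l + k) *\<^sub>R a + k *\<^sub>R u"
      by (simp add: scaleR_add_left scaleR_add_right)
    ultimately have "x = c + a + k *\<^sub>R u" by (simp add: \<open>l + k = 1\<close>)
    then show ?thesis ..
  qed
  have "b \<in> affine hull {b, b + w}" "b + w \<in> affine hull {b, b + w}"
    by (simp_all add: hull_inc)
  then obtain k l where "b = c + a + k *\<^sub>R u" "b + w = c + a + l *\<^sub>R u"
    using pt by meson
  then have "w = (l - k) *\<^sub>R u" by (simp add: algebra_simps)
  then show ?thesis by simp
qed

lemma parallel_edges_commute: "parallel_edges e e' \<longleftrightarrow> parallel_edges e' e"
  unfolding parallel_edges_def by (metis affine_parallel_commute)

lemma tile_edge_rep: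
  assumes "parallelogram T" "side P q edge_of T"
  obtains w where "T = para P q w" "cross2 q w \<noteq> 0"
proof -
  from assms(1) obtain a u v where T: "T = para a u v" and nz: "cross2 u v \<noteq> 0"
    by (rule parallelogramE)
  with assms(2) obtain P' q' w where rep: "(P', q', w) \<in> side_reps a u v" and eq: "side P q = side P' q'"
    using edge_of_para_cases by metis
  note T' = side_reps_para[OF rep nz]
  from eq consider "P' = P" "q' = q" | "P' = P + q" "q' = - q"
    unfolding side_eq_iff by auto
  then show ?thesis
    by cases (use T T' that[of w] in \<open>simp_all add: para_flip1\<close>)
qed

lemma edge_of_tileE:
  assumes "parallelogram T" "e edge_of T"
  obtains P q w where "e = side P q" "T = para P q w" "cross2 q w \<noteq> 0"
proof -
  from assms(1) obtain a u v where T: "T = para a u v" and nz: "cross2 u v \<noteq> 0"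
    by (rule parallelogramE)
  with assms(2) obtain P q w where rep: "(P, q, w) \<in> side_reps a u v" and eq: "e = side P q"
    using edge_of_para_cases by metis
  with side_reps_para[OF rep nz] T that[of P q w] show ?thesis by simp
qed

lemma parallel_edge_of_para:
  assumes nz: "cross2 u v \<noteq> 0" and e: "side b w edge_of para a u v" and par: "cross2 u w = 0"
  shows "side b w = side a u \<or> side b w = side (a + v) u"
proof -
  from edge_of_para_cases[OF nz e] obtain P q x where rep: "(P, q, x) \<in> side_reps a u v"
    and eq: "side b w = side P q" by metis
  from eq have "q = w \<or> q = - w" unfolding side_eq_iff by auto
  with par have "cross2 u q = 0" by auto
  with nz have "q \<noteq> v" by auto
  with rep eq show ?thesis by (auto simp: side_reps_def)
qed

lemma nonparallel_edge_of_para: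
  assumes nz: "cross2 u v \<noteq> 0" and e: "side b w edge_of para a u v" and par: "cross2 u w \<noteq> 0"
  shows "side b w = side a v \<or> side b w = side (a + u) v"
proof -
  have "cross2 v w = 0"
  proof -
    from edge_of_para_cases[OF nz e] obtain P q x where rep: "(P, q, x) \<in> side_reps a u v"
      and eq: "side b w = side P q" by metis
    from eq have "w = q \<or> w = - q" unfolding side_eq_iff by auto
    with rep par show ?thesis by (auto simp: side_reps_def)
  qed
  then show ?thesis
    using parallel_edge_of_para[of v u b w a] nz e cross2_commute[of u v] by (simp add: para_swap[of a v])
qed

lemma opposite_edge_of_para:
  assumes nz: "cross2 u v \<noteq> 0" and e: "e edge_of para a u v" "e \<noteq> side a u"
    and par: "parallel_edges (side a u) e"
  shows "e = side (a + v) u"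
proof -
  from edge_of_para_cases[OF nz e(1)] obtain P q x where eq: "e = side P q" by metis
  with parallel_edge_of_para[OF nz] e par parallel_edges_side show ?thesis by metis
qed

text \<open>The sign condition says that \<open>d\<close> and \<open>w\<close> point to the same
  side of the line of \<open>q\<close>, so a short move along \<open>d\<close> from inside the side
  enters the parallelogram.\<close>

lemma interior_para_approach:
  assumes nz: "cross2 q w \<noteq> 0" and s: "0 < s" "s < 1" and pos: "cross2 q d * cross2 q w > 0"
  shows "\<exists>\<delta>>0. \<forall>\<epsilon>. 0 < \<epsilon> \<and> \<epsilon> < \<delta> \<longrightarrow> P + s *\<^sub>R q + \<epsilon> *\<^sub>R d \<in> interior (para P q w)"
proof -
  define \<alpha> where "\<alpha> = cross2 d w / cross2 q w"
  define \<beta> where "\<beta> = cross2 q d / cross2 q w"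
  have d: "d = \<alpha> *\<^sub>R q + \<beta> *\<^sub>R w"
    unfolding \<alpha>_def \<beta>_def by (rule cross2_basis[OF nz])
  have \<beta>: "\<beta> > 0"
    using pos by (simp add: \<beta>_def zero_less_divide_iff zero_less_mult_iff)
  \<comment> \<open>The first bound keeps the coordinate along \<open>w\<close> below 1, the second
    keeps the coordinate along \<open>q\<close> within (0, 1); the summand 1 avoids a zero
    denominator.\<close>
  define \<delta> where "\<delta> = min (1 / \<beta>) (min s (1 - s) / (1 + \<bar>\<alpha>\<bar>))"
  have "\<delta> > 0" using \<beta> s by (simp add: \<delta>_def)
  moreover have "P + s *\<^sub>R q + \<epsilon> *\<^sub>R d \<in> interior (para P q w)" if \<epsilon>: "0 < \<epsilon>" "\<epsilon> < \<delta>" for \<epsilon>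
  proof -
    have "\<epsilon> < 1 / \<beta>" "\<epsilon> < min s (1 - s) / (1 + \<bar>\<alpha>\<bar>)" using \<epsilon> by (simp_all add: \<delta>_def)
    then have "\<epsilon> * \<beta> < 1" and "\<epsilon> * (1 + \<bar>\<alpha>\<bar>) < min s (1 - s)"
      using \<beta> by (simp_all add: pos_less_divide_eq)
    then have "\<bar>\<epsilon> * \<alpha>\<bar> < min s (1 - s)"
      using \<epsilon> by (simp add: abs_mult algebra_simps)
    then have "0 < s + \<epsilon> * \<alpha>" "s + \<epsilon> * \<alpha> < 1" by linarith+
    moreover have "P + s *\<^sub>R q + \<epsilon> *\<^sub>R d = P + (s + \<epsilon> * \<alpha>) *\<^sub>R q + (\<epsilon> * \<beta>) *\<^sub>R w"
      by (subst d) (simp add: algebra_simps)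
    ultimately show ?thesis
      using interior_para[OF nz, of "s + \<epsilon> * \<alpha>" "\<epsilon> * \<beta>" P] \<open>\<epsilon> * \<beta> < 1\<close> \<epsilon> \<beta>
      by (simp only: mult_pos_pos)
  qed
  ultimately show ?thesis by blast
qed

lemma interior_para_meet:
  assumes pos: "cross2 q w * cross2 q w' > 0"
  shows "interior (para P q w) \<inter> interior (para P q w') \<noteq> {}"
proof -
  have nz: "cross2 q w \<noteq> 0" "cross2 q w' \<noteq> 0" using pos by auto
  obtain \<delta> where \<delta>: "\<delta> > 0"
    "\<forall>\<epsilon>. 0 < \<epsilon> \<and> \<epsilon> < \<delta> \<longrightarrow> P + (1/2) *\<^sub>R q + \<epsilon> *\<^sub>R w \<in> interior (para P q w)"
    using interior_para_approach[OF nz(1), of "1/2" w P] nz by (auto simp flip: power2_eq_square)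
  obtain \<delta>' where \<delta>': "\<delta>' > 0"
    "\<forall>\<epsilon>. 0 < \<epsilon> \<and> \<epsilon> < \<delta>' \<longrightarrow> P + (1/2) *\<^sub>R q + \<epsilon> *\<^sub>R w \<in> interior (para P q w')"
    using interior_para_approach[OF nz(2), of "1/2" w P] pos by auto
  obtain \<epsilon> where "0 < \<epsilon>" "\<epsilon> < min \<delta> \<delta>'"
    using dense[of 0 "min \<delta> \<delta>'"] \<delta>(1) \<delta>'(1) by auto
  with \<delta>(2) \<delta>'(2) show ?thesis by auto
qed

section \<open>Vertex-to-vertex parallelogram tilings\<close>

locale v2v_tiling =
  fixes \<T> :: "(real^2) set set"
  assumes tiling: "parallelogram_tiling \<T>"
    and locally_finite: "locally_finite_tiling \<T>"
    and v2v: "vertex_to_vertex \<T>"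
begin

lemma parallelogram_tile: "T \<in> \<T> \<Longrightarrow> parallelogram T"
  using tiling by (auto simp: parallelogram_tiling_def)

lemma tiles_cover: "\<exists>T\<in>\<T>. x \<in> T"
  using tiling by (auto simp: parallelogram_tiling_def)

lemma interior_disjoint: "T \<in> \<T> \<Longrightarrow> T' \<in> \<T> \<Longrightarrow> T \<noteq> T' \<Longrightarrow> interior T \<inter> interior T' = {}"
  using tiling unfolding parallelogram_tiling_def by blast

text \<open>A convex set with nonempty interior lies in the closure of that interior, and an open
  set that misses a set misses its closure.\<close>

lemma interior_disjoint_tile:
  assumes "T \<in> \<T>" "T' \<in> \<T>" "T \<noteq> T'"
  shows "interior T \<inter> T' = {}"
proof -
  from parallelogram_tile[OF assms(2)] obtain a u v where "T' = para a u v"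
    by (rule parallelogramE)
  moreover have "interior T' \<noteq> {}"
    using parallelogram_tile[OF assms(2)] by (simp add: parallelogram_def)
  ultimately have "closure (interior T') = closure T'"
    using convex_closure_interior convex_para by blast
  then have "T' \<subseteq> closure (interior T')"
    using closure_subset by blast
  moreover have "interior T \<inter> closure (interior T') = {}"
    using interior_disjoint[OF assms] open_Int_closure_eq_empty by blast
  ultimately show ?thesis by blast
qed

lemma vertex_in_tile:
  "T \<in> \<T> \<Longrightarrow> T' \<in> \<T> \<Longrightarrow> x extreme_point_of T \<Longrightarrow> x \<in> T' \<Longrightarrow> x extreme_point_of T'"
  using v2v unfolding vertex_to_vertex_def by blast

text \<open>On the same side of the common edge the two tiles would overlap just above its
  midpoint.\<close>

lemma tiles_opposite:
  assumes "para P q w \<in> \<T>" "para P q w' \<in> \<T>" "para P q w \<noteq> para P q w'"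
    "cross2 q w \<noteq> 0" "cross2 q w' \<noteq> 0"
  shows "cross2 q w * cross2 q w' < 0"
  using interior_para_meet[of q w w' P] interior_disjoint[OF assms(1-3)] assms(4,5)
  by (meson linorder_neqE_linordered_idom mult_eq_0_iff)

lemma neighbour_unique:
  assumes T: "T \<in> \<T>" "T\<^sub>1 \<in> \<T>" "T\<^sub>2 \<in> \<T>" and e: "e edge_of T" "e edge_of T\<^sub>1" "e edge_of T\<^sub>2"
    and ne: "T\<^sub>1 \<noteq> T" "T\<^sub>2 \<noteq> T"
  shows "T\<^sub>1 = T\<^sub>2"
proof (rule ccontr)
  assume ne': "T\<^sub>1 \<noteq> T\<^sub>2"
  obtain P q w where q: "e = side P q" "T = para P q w" "cross2 q w \<noteq> 0"
    using edge_of_tileE parallelogram_tile T e by metis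
  obtain w\<^sub>1 where w1: "T\<^sub>1 = para P q w\<^sub>1" "cross2 q w\<^sub>1 \<noteq> 0"
    using tile_edge_rep parallelogram_tile T e q by metis
  obtain w\<^sub>2 where w2: "T\<^sub>2 = para P q w\<^sub>2" "cross2 q w\<^sub>2 \<noteq> 0"
    using tile_edge_rep parallelogram_tile T e q by metis
  \<comment> \<open>Three nonzero reals cannot have pairwise opposite signs.\<close>
  have "cross2 q w * cross2 q w\<^sub>1 < 0" "cross2 q w * cross2 q w\<^sub>2 < 0" "cross2 q w\<^sub>1 * cross2 q w\<^sub>2 < 0"
    using tiles_opposite q w1 w2 T ne ne' by metis+
  then show False
    by (smt (verit) mult_less_0_iff)
qed

lemma vertex_not_inside_side:
  assumes "para P q w \<in> \<T>" "para P' q' w' \<in> \<T>" "cross2 q w \<noteq> 0" "cross2 q' w' \<noteq> 0"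
    and P': "P' = P + s *\<^sub>R q" "0 < s" "s < 1"
  shows False
proof -
  have "q \<noteq> 0" using assms by auto
  have "P' \<in> para P q w"
    using paraI[of s 0 P q w] P' by simp
  with side_endpoints_extreme(1)[OF assms(4)] have "P' extreme_point_of para P q w"
    using vertex_in_tile assms by blast
  moreover have "P' = (1 - s) *\<^sub>R P + s *\<^sub>R (P + q)"
    using P' by (simp add: algebra_simps)
  then have "P' \<in> open_segment P (P + q)"
    using P' \<open>q \<noteq> 0\<close> unfolding in_segment by auto
  moreover have "P \<in> para P q w" "P + q \<in> para P q w"
    using side_endpoints_extreme[OF assms(3), of P] by (auto simp: extreme_point_of_def)
  ultimately show False
    by (auto simp: extreme_point_of_def)
qed

text \<open>The sides point the same way along one line and overlap. If their initial points
  differed, the one further along would be a vertex strictly inside the other side.\<close>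

lemma aligned_sides_eq:
  assumes T: "para P q w \<in> \<T>" "para P' q' w' \<in> \<T>" "cross2 q w \<noteq> 0" "cross2 q' w' \<noteq> 0"
    and l: "q' = l *\<^sub>R q" "l > 0" and z: "P + s *\<^sub>R q = P' + s' *\<^sub>R q'"
    and s: "0 < s" "s < 1" "0 < s'" "s' < 1"
  shows "P = P'"
proof (rule ccontr)
  assume "P \<noteq> P'"
  have P': "P' = P + (s - s' * l) *\<^sub>R q"
    using z l by (simp add: algebra_simps)
  have "s' * l > 0" using s l by simp
  have "s \<noteq> s' * l" using P' \<open>P \<noteq> P'\<close> by auto
  then consider "s > s' * l" | "s < s' * l" by linarith
  then show False
  proof cases
    case 1
    with vertex_not_inside_side[OF T P'] s \<open>s' * l > 0\<close> show False by simp
  next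
    case 2
    have "P = P' + (s' - s / l) *\<^sub>R q'"
      using z l by (simp add: algebra_simps)
    moreover have "0 < s' - s / l" "s' - s / l < 1"
    proof -
      have "s / l < s'" "s / l > 0" using 2 l s by (simp_all add: pos_divide_less_eq)
      with s show "0 < s' - s / l" "s' - s / l < 1" by linarith+
    qed
    ultimately show False
      using vertex_not_inside_side[OF T(2,1,4,3)] by blast
  qed
qed

text \<open>The common point lies strictly inside a side of each tile. These sides are collinear,
  since otherwise one tile would run into the interior of the other; then vertex-to-vertex forces
  their endpoints to agree.\<close>

lemma common_edge:
  assumes T: "T \<in> \<T>" "T' \<in> \<T>" "T \<noteq> T'" and z: "z \<in> T" "z \<in> T'" "\<not> z extreme_point_of T"
  obtains e where "z \<in> e" "e edge_of T" "e edge_of T'"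
proof -
  have z': "\<not> z extreme_point_of T'"
    using vertex_in_tile T z by blast
  have int: "z \<notin> interior T" "z \<notin> interior T'"
    using interior_disjoint_tile T z by blast+
  obtain P q w s where Pq: "T = para P q w" "cross2 q w \<noteq> 0" and s: "0 < s" "s < 1" "z = P + s *\<^sub>R q"
    using para_boundaryE side_reps_para parallelogramE[OF parallelogram_tile[OF T(1)]] z int
    by (metis (no_types))
  obtain P' q' w' s' where Pq': "T' = para P' q' w'" "cross2 q' w' \<noteq> 0" and s': "0 < s'" "s' < 1" "z = P' + s' *\<^sub>R q'"
    using para_boundaryE side_reps_para parallelogramE[OF parallelogram_tile[OF T(2)]] z z' int
    by (metis (no_types))
  \<comment> \<open>The two values of \<open>c\<close> are the two ways to move along the side of
    \<open>T'\<close>; if \<open>q'\<close> were not parallel to \<open>q\<close>, one of them would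
    enter \<open>T\<close>.\<close>
  have approach: "\<not> cross2 q (c *\<^sub>R q') * cross2 q w > 0" if c: "c = 1 \<or> c = -1" for c
  proof
    assume "cross2 q (c *\<^sub>R q') * cross2 q w > 0"
    then obtain \<delta> where \<delta>: "\<delta> > 0"
      "\<forall>\<epsilon>. 0 < \<epsilon> \<and> \<epsilon> < \<delta> \<longrightarrow> P + s *\<^sub>R q + \<epsilon> *\<^sub>R (c *\<^sub>R q') \<in> interior (para P q w)"
      using interior_para_approach[OF Pq(2) s(1,2), of "c *\<^sub>R q'" P] by auto
    obtain \<epsilon> where \<epsilon>: "0 < \<epsilon>" "\<epsilon> < min \<delta> (min s' (1 - s'))"
      using dense[of 0 "min \<delta> (min s' (1 - s'))"] \<delta>(1) s' by auto
    have "z + \<epsilon> *\<^sub>R (c *\<^sub>R q') \<in> interior T"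
      using \<delta> \<epsilon> s Pq by simp
    moreover have "z + \<epsilon> *\<^sub>R (c *\<^sub>R q') = P' + (s' + \<epsilon> * c) *\<^sub>R q'"
      by (simp add: s' algebra_simps)
    then have "z + \<epsilon> *\<^sub>R (c *\<^sub>R q') \<in> T'"
      using paraI[of "s' + \<epsilon> * c" 0 P' q' w'] Pq'(1) \<epsilon> c by auto
    ultimately show False
      using interior_disjoint_tile[OF T] by blast
  qed
  have "cross2 q q' = 0"
  proof (rule ccontr)
    assume "cross2 q q' \<noteq> 0"
    with Pq(2) have "cross2 q q' * cross2 q w > 0 \<or> - cross2 q q' * cross2 q w > 0"
      by (simp add: zero_less_mult_iff mult_less_0_iff) linarith
    with approach[of 1] approach[of "-1"] show False by auto
  qed
  moreover have "q \<noteq> 0" "q' \<noteq> 0" using Pq Pq' by auto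
  ultimately obtain l where l: "q' = l *\<^sub>R q" "l \<noteq> 0"
    using cross2_eq_0_iff by auto
  have main: "side P q = side P' q'"
    if Pq': "T' = para P' q' w'" "cross2 q' w' \<noteq> 0" and s': "0 < s'" "s' < 1" "z = P' + s' *\<^sub>R q'"
      and l: "q' = l *\<^sub>R q" "l > 0" for P' q' s' l
  proof -
    have "P = P'"
      using aligned_sides_eq[of P q w P' q' w' l s s'] T Pq Pq' s s' l by simp
    \<comment> \<open>The same comparison with both sides traversed backwards handles the other
      endpoints.\<close>
    moreover have "P + q = P' + q'"
      using aligned_sides_eq[of "P + q" "- q" w "P' + q'" "- q'" w' l "1 - s" "1 - s'"] T Pq Pq' s s' l
      by (simp add: para_flip1 algebra_simps)
    ultimately show ?thesis by simp
  qed
  have eq: "side P q = side P' q'"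
  proof (cases "l > 0")
    case True
    then show ?thesis using main Pq' s' l by blast
  next
    case False
    have "side P q = side (P' + q') (- q')"
      using main[of "P' + q'" "- q'" "1 - s'" "- l"] Pq' s' l False
      by (simp add: para_flip1 algebra_simps)
    then show ?thesis by (simp add: side_flip)
  qed
  show ?thesis
  proof
    show "z \<in> side P q"
      unfolding mem_side using s by (intro exI[of _ s]) simp
    show "side P q edge_of T"
      unfolding Pq(1) by (rule side_edge_of_para[OF Pq(2)])
    show "side P q edge_of T'"
      unfolding eq Pq'(1) by (rule side_edge_of_para[OF Pq'(2)])
  qed
qed

section \<open>Worms with their edge sequences, and how one tile and edge determine them\<close>

definition links :: "(int \<Rightarrow> (real^2) set) \<Rightarrow> (int \<Rightarrow> (real^2) set) \<Rightarrow> bool" where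
  "links W E \<longleftrightarrow> (\<forall>i. W i \<in> \<T> \<and> W (i + 1) \<noteq> W i \<and> E i edge_of W i \<and> E i edge_of W (i + 1) \<and>
     E (i + 1) \<noteq> E i \<and> parallel_edges (E i) (E (i + 1)))"

lemma links_pred:
  assumes "links W E"
  shows "W (i - 1) \<noteq> W i" "E (i - 1) edge_of W i" "E (i - 1) \<noteq> E i" "parallel_edges (E (i - 1)) (E i)"
  using assms[unfolded links_def, rule_format, of "i - 1"] by auto

lemma worm_links: "worm \<T> W \<Longrightarrow> \<exists>E. links W E"
  by (auto simp: worm_def worm_from_def links_def)

lemma worm_family_links: "W \<in> worm_family \<T> e \<Longrightarrow> \<exists>E. links W E \<and> parallel_edges e (E 0)"
  by (auto simp: worm_family_def worm_from_def links_def)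

text \<open>\<open>E i\<close> sits between \<open>W i\<close> and \<open>W (i + 1)\<close>, so the
  edge between \<open>W (- i)\<close> and \<open>W (- i - 1)\<close> has index
  \<open>- i - 1\<close>.\<close>

lemma links_reverse:
  assumes "links W E"
  shows "links (\<lambda>i. W (- i)) (\<lambda>i. E (- i - 1))"
  unfolding links_def
proof (intro allI conjI)
  fix i :: int
  have "- i - 1 + 1 = - i" "- (i + 1) = - i - 1" "- i - 1 - 1 = - i - 2" "- i - 2 + 1 = - i - 1"
    by simp_all
  note eqs = this
  note l = assms[unfolded links_def, rule_format, of "- i - 1", unfolded eqs]
    assms[unfolded links_def, rule_format, of "- i - 2", unfolded eqs]
    assms[unfolded links_def, rule_format, of "- i"]
  show "W (- i) \<in> \<T>" "W (- (i + 1)) \<noteq> W (- i)" "E (- i - 1) edge_of W (- i)"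
    "E (- i - 1) edge_of W (- (i + 1))" "E (- (i + 1) - 1) \<noteq> E (- i - 1)"
    "parallel_edges (E (- i - 1)) (E (- (i + 1) - 1))"
    unfolding eqs using l parallel_edges_commute by blast+
qed

lemma opposite_edge_unique:
  assumes "T \<in> \<T>" "e edge_of T"
    and "e' edge_of T" "e' \<noteq> e" "parallel_edges e e'"
    and "e'' edge_of T" "e'' \<noteq> e" "parallel_edges e e''"
  shows "e' = e''"
proof -
  obtain P q w where q: "e = side P q" "T = para P q w" "cross2 q w \<noteq> 0"
    using edge_of_tileE parallelogram_tile assms(1,2) by metis
  then show ?thesis
    using opposite_edge_of_para[OF q(3)] assms by metis
qed

text \<open>A tile alone does not fix the continuation, so edges are carried along: the exit edge
  fixes the next tile, and that tile fixes the opposite edge.\<close>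

lemma links_determined_forward:
  assumes W: "links W E" "links W' E'" and eq: "W' j = W i" "E' j = E i"
  shows "W' (j + int n) = W (i + int n) \<and> E' (j + int n) = E (i + int n)"
proof (induction n)
  case 0
  then show ?case using eq by simp
next
  case (Suc n)
  let ?i = "i + int n" and ?j = "j + int n"
  note l = W(1)[unfolded links_def, rule_format, of ?i] W(1)[unfolded links_def, rule_format, of "?i + 1"]
  note l' = W(2)[unfolded links_def, rule_format, of ?j] W(2)[unfolded links_def, rule_format, of "?j + 1"]
  have W': "W' (?j + 1) = W (?i + 1)"
    using neighbour_unique[of "W ?i" "W' (?j + 1)" "W (?i + 1)" "E ?i"] l l' Suc by simp
  have "E' (?j + 1) = E (?i + 1)"
    using opposite_edge_unique[of "W (?i + 1)" "E ?i" "E' (?j + 1)" "E (?i + 1)"] l l' Suc W' by simp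
  with W' show ?case by (simp add: algebra_simps)
qed

lemma links_determined:
  assumes W: "links W E" "links W' E'" and eq: "W' j = W i" "E' j = E i"
  shows "W' k = W (k + (i - j))"
proof (cases "k \<ge> j")
  case True
  then show ?thesis
    using links_determined_forward[OF assms, of "nat (k - j)"] by (simp add: algebra_simps)
next
  case False
  \<comment> \<open>The reversed sequences leave these tiles through the preceding edges, so
    agreement is needed there before the forward result applies to them.\<close>
  have "E' (j - 1) = E (i - 1)"
    using opposite_edge_unique[of "W i" "E i" "E' (j - 1)" "E (i - 1)"] eq links_pred[OF W(1), of i]
      links_pred[OF W(2), of j] W(1) parallel_edges_commute unfolding links_def by metis
  then have "W' (- (- j + int n)) = W (- (- i + int n))" for n
    using links_determined_forward[OF links_reverse[OF W(1)] links_reverse[OF W(2)], of "- j" "- i" n] eq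
    by simp
  from this[of "nat (j - k)"] False show ?thesis by (simp add: algebra_simps)
qed

text \<open>The shared tile has only two edges parallel to \<open>u\<close>, namely
  \<open>E i\<close> and \<open>E (i - 1)\<close>. Leaving through the first gives an index shift,
  through the second a reversal.\<close>

lemma same_worm_if_parallel:
  assumes W: "links W E" "links W' E'" and eq: "W' j = W i"
    and E: "E i = side P u" "E' j = side P' u'" "cross2 u u' = 0"
  shows "same_worm W W'"
proof -
  note l = W(1)[unfolded links_def, rule_format, of i] and l' = W(2)[unfolded links_def, rule_format, of j]
  obtain w where w: "W i = para P u w" "cross2 u w \<noteq> 0"
    using tile_edge_rep parallelogram_tile l E(1) by metis
  have "E (i - 1) = side (P + w) u"
    using opposite_edge_of_para[OF w(2)] links_pred[OF W(1), of i] E(1) w parallel_edges_commute by metis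
  then consider "E' j = E i" | "E' j = E (i - 1)"
    using parallel_edge_of_para[OF w(2), of P' u' P] l' eq w E by metis
  then show ?thesis
  proof cases
    case 1
    then show ?thesis
      using links_determined[OF W eq] unfolding same_worm_def by blast
  next
    case 2
    then have "W' k = W (- (k + (- i - j)))" for k
      using links_determined[OF links_reverse[OF W(1)] W(2), of j "- i"] eq by simp
    then have "\<forall>k. W' k = W (i + j - k)"
      by (simp add: algebra_simps)
    then show ?thesis
      unfolding same_worm_def by blast
  qed
qed

section \<open>Worms as strips of parallelograms\<close>

text \<open>One vector \<open>u\<close> serves for all edges, while the steps \<open>w i\<close>
  between them may bend. The sign condition says that the worm always advances to the same side of
  direction \<open>u\<close>.\<close>

definition strip where
  "strip W E p u w \<longleftrightarrow> links W E \<and> u \<noteq> 0 \<and>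
     (\<forall>i. E i = side (p i) u \<and> W i = para (p (i - 1)) u (w i) \<and> p i = p (i - 1) + w i) \<and>
     (\<forall>i j. cross2 u (w i) * cross2 u (w j) > 0)"

lemma stripD:
  assumes "strip W E p u w"
  shows "E i = side (p i) u" "W i = para (p (i - 1)) u (w i)" "p i = p (i - 1) + w i"
    and "cross2 u (w i) * cross2 u (w j) > 0"
    and strip_links: "links W E" and "u \<noteq> 0"
proof -
  note * = assms[unfolded strip_def]
  show "E i = side (p i) u" "W i = para (p (i - 1)) u (w i)" "p i = p (i - 1) + w i"
    using *[THEN conjunct2, THEN conjunct2, THEN conjunct1, THEN spec, of i] by blast+
  show "cross2 u (w i) * cross2 u (w j) > 0"
    using *[THEN conjunct2, THEN conjunct2, THEN conjunct2] by blast
  show "links W E" "u \<noteq> 0"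
    using *[THEN conjunct1] *[THEN conjunct2, THEN conjunct1] by blast+
qed

lemma strip_facts:
  assumes "strip W E p u w"
  shows "W i \<in> \<T>" "W i = para (p i) u (- w i)" "cross2 u (w i) \<noteq> 0"
proof -
  show "W i \<in> \<T>"
    using strip_links[OF assms] unfolding links_def by blast
  show "W i = para (p i) u (- w i)"
    using para_flip2[of "p (i - 1)" "w i" u] stripD(2)[OF assms, of i]
    by (simp flip: stripD(3)[OF assms, of i])
  show "cross2 u (w i) \<noteq> 0"
    using stripD(4)[OF assms, of i i] by auto
qed

lemma strip_exists:
  assumes W: "links W E"
  obtains p u w where "strip W E p u w"
proof -
  note l = W[unfolded links_def, rule_format]
  obtain P u v where 0: "E 0 = side P u" "cross2 u v \<noteq> 0"
    using edge_of_tileE[of "W 0" "E 0"] l[of 0] parallelogram_tile by metis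
  \<comment> \<open>Each edge is the opposite edge of the previous one in a parallelogram, so the
    vector \<open>u\<close> is inherited in both directions from index 0.\<close>
  have "\<exists>P. E i = side P u" for i
  proof (induction i rule: int_induct[where k = 0])
    case base
    show ?case using 0 by blast
  next
    case (step1 i)
    then obtain P where P: "E i = side P u" by blast
    obtain w where "W (i + 1) = para P u w" "cross2 u w \<noteq> 0"
      using tile_edge_rep parallelogram_tile l P by metis
    then have "E (i + 1) = side (P + w) u"
      using opposite_edge_of_para[of u w "E (i + 1)" P] l[of i] l[of "i + 1"] P by metis
    then show ?case by blast
  next
    case (step2 i)
    then obtain P where P: "E i = side P u" by blast
    obtain w where "W i = para P u w" "cross2 u w \<noteq> 0"
      using tile_edge_rep parallelogram_tile l P by metis
    then have "E (i - 1) = side (P + w) u"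
      using opposite_edge_of_para[of u w "E (i - 1)" P] links_pred[OF W, of i] P parallel_edges_commute
      by metis
    then show ?case by blast
  qed
  then obtain p where p: "E i = side (p i) u" for i by metis
  define w where "w i = p i - p (i - 1)" for i
  have rep: "W i = para (p (i - 1)) u (w i) \<and> cross2 u (w i) \<noteq> 0" for i
  proof -
    obtain w' where w': "W i = para (p (i - 1)) u w'" "cross2 u w' \<noteq> 0"
      using tile_edge_rep parallelogram_tile l p links_pred[OF W, of i] by metis
    then have "E i = side (p (i - 1) + w') u"
      using opposite_edge_of_para[of u w' "E i" "p (i - 1)"] l[of i] links_pred[OF W, of i] p by metis
    then have "p i = p (i - 1) + w'"
      using p side_eq_same_vector by metis
    then have "w i = w'" by (simp add: w_def)
    with w' show ?thesis by simp
  qed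
  have pw: "p (i - 1) + w i = p i" for i by (simp add: w_def)
  \<comment> \<open>Seen from the common edge, the two tiles lie on opposite sides; based there,
    \<open>W i\<close> has the vector \<open>- w i\<close>, which turns opposite signs into equal
    ones.\<close>
  have step: "cross2 u (w i) * cross2 u (w (i + 1)) > 0" for i
  proof -
    have 1: "W (i + 1) = para (p i) u (w (i + 1))"
      using rep[of "i + 1"] by simp
    have 2: "W i = para (p i) u (- w i)"
      using rep[of i] para_flip2[of "p (i - 1)" "w i" u] by (simp add: pw)
    have "cross2 u (- w i) * cross2 u (w (i + 1)) < 0"
      using tiles_opposite[of "p i" u "- w i" "w (i + 1)"] 1 2 l[of i] l[of "i + 1"] rep[of i] rep[of "i + 1"]
      by (metis cross2_simps(6) neg_equal_0_iff_equal)
    then show ?thesis by simp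
  qed
  have from0: "cross2 u (w 0) * cross2 u (w i) > 0" for i
  proof (induction i rule: int_induct[where k = 0])
    case base
    then show ?case using rep[of 0] by (simp flip: power2_eq_square)
  next
    case (step1 i)
    then show ?case using step[of i] by (auto simp: zero_less_mult_iff)
  next
    case (step2 i)
    then show ?case using step[of "i - 1"] by (auto simp: zero_less_mult_iff)
  qed
  have "cross2 u (w i) * cross2 u (w j) > 0" for i j
    using from0[of i] from0[of j] by (auto simp: zero_less_mult_iff)
  moreover have "u \<noteq> 0" using 0(2) by auto
  ultimately have "strip W E p u w"
    unfolding strip_def using W p rep pw by simp
  then show ?thesis by (rule that)
qed

text \<open>Same worm, with the other boundary line as base. This exchanges the two directions in
  which it can be crossed.\<close>

lemma strip_flip:
  assumes "strip W E p u w"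
  shows "strip W E (\<lambda>i. p i + u) (- u) w"
proof -
  have "p i + u = p (i - 1) + u + w i" for i
    using stripD(3)[OF assms, of i] by (metis add.assoc add.commute)
  moreover have "cross2 (- u) (w i) * cross2 (- u) (w j) > 0" for i j
    using stripD(4)[OF assms] by simp
  moreover have "- u \<noteq> 0"
    using stripD(6)[OF assms] by simp
  ultimately show ?thesis
    unfolding strip_def side_flip para_flip1
    using strip_links[OF assms] stripD(1,2)[OF assms] by blast
qed

section \<open>The transverse coordinate of a worm and its lift to a height\<close>

text \<open>If a tile were to occur several times in \<open>W\<close>, its two left ends \<open>p (i - 1)\<close>, \<open>p i\<close> would still
  be the same up to order, so any occurrence may be chosen.\<close>

definition cross_coord where
  "cross_coord W p u w T z =
     (if T \<in> range W then let i = (SOME i. W i = T) in cross2 (z - p (i - 1)) (w i) / cross2 u (w i) else 0)"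

lemma cross_coordE:
  assumes "T \<in> range W"
  obtains i where "W i = T"
    "\<forall>z. cross_coord W p u w T z = cross2 (z - p (i - 1)) (w i) / cross2 u (w i)"
proof
  show "W (SOME i. W i = T) = T"
    using assms by (metis (mono_tags) imageE someI_ex)
  show "\<forall>z. cross_coord W p u w T z = cross2 (z - p ((SOME i. W i = T) - 1)) (w (SOME i. W i = T)) /
    cross2 u (w (SOME i. W i = T))"
    using assms by (simp add: cross_coord_def Let_def)
qed

text \<open>Only \<open>W i\<close> and \<open>W (i + 1)\<close> have this edge. Whichever
  occurrence of the tile is chosen, the edge is one of its two sides with vector \<open>u\<close>,
  based at coordinate 0, so both tiles give exactly the same value.\<close>

lemma cross_coord_strip_edge:
  assumes s: "strip W E p u w" and T: "T \<in> \<T>" and e: "E i edge_of T"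
  shows "T \<in> range W" and "cross_coord W p u w T (p i + r *\<^sub>R u) = r"
proof -
  note l = strip_links[OF s, unfolded links_def, rule_format, of i]
    and l' = strip_links[OF s, unfolded links_def, rule_format, of "i + 1"]
  show rng: "T \<in> range W"
    using neighbour_unique[of "W i" "W (i + 1)" T "E i"] l l' T e by blast
  then obtain k where k: "W k = T"
    "\<forall>z. cross_coord W p u w T z = cross2 (z - p (k - 1)) (w k) / cross2 u (w k)"
    by (rule cross_coordE[where p = p and u = u and w = w])
  note D = stripD(2,3)[OF s, of k] strip_facts(3)[OF s, of k]
  have "side (p i) u edge_of para (p (k - 1)) u (w k)"
    using e k D(1) stripD(1)[OF s, of i] by simp
  from parallel_edge_of_para[OF D(3) this] have "p i = p (k - 1) \<or> p i = p (k - 1) + w k"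
    using side_eq_same_vector by auto
  then show "cross_coord W p u w T (p i + r *\<^sub>R u) = r"
    using D(3) by (auto simp: k(2))
qed

text \<open>In a tile of \<open>W\<close> the two sides with vector \<open>u\<close> belong to
  \<open>E\<close>. The remaining two are the boundary sides, with coordinate 0 and 1; off
  \<open>W\<close> the default value 0 applies.\<close>

lemma cross_coord_other_edge:
  assumes s: "strip W E p u w" and e: "e edge_of T" "e \<notin> range E" "z \<in> e"
  shows "cross_coord W p u w T z \<in> \<int>"
proof (cases "T \<in> range W")
  case True
  then obtain k where k: "W k = T"
    "\<forall>z. cross_coord W p u w T z = cross2 (z - p (k - 1)) (w k) / cross2 u (w k)"
    by (rule cross_coordE[where p = p and u = u and w = w])
  note D = stripD(2,3)[OF s, of k] strip_facts(3)[OF s, of k]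
  have "e edge_of para (p (k - 1)) u (w k)"
    using e k D by simp
  then obtain P q x where rep: "(P, q, x) \<in> side_reps (p (k - 1)) u (w k)" and eq: "e = side P q"
    using edge_of_para_cases[OF D(3)] by metis
  have "e \<noteq> side (p (k - 1)) u" "e \<noteq> side (p (k - 1) + w k) u"
    using e(2) D(2) stripD(1)[OF s, of k] stripD(1)[OF s, of "k - 1"] by auto
  with rep eq have "e = side (p (k - 1)) (w k) \<or> e = side (p (k - 1) + u) (w k)"
    by (auto simp: side_reps_def)
  with e(3) D(3) show ?thesis
    by (auto simp: mem_side k(2))
qed (simp add: cross_coord_def)

lemma cross_coord_vertex:
  assumes s: "strip W E p u w" and z: "z extreme_point_of T"
  shows "cross_coord W p u w T z \<in> \<int>"
proof (cases "T \<in> range W")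
  case True
  then obtain k where k: "W k = T"
    "\<forall>z. cross_coord W p u w T z = cross2 (z - p (k - 1)) (w k) / cross2 u (w k)"
    by (rule cross_coordE[where p = p and u = u and w = w])
  note D = stripD(2,3)[OF s, of k] strip_facts(3)[OF s, of k]
  have "z extreme_point_of convex hull {p (k - 1), p (k - 1) + u, p (k - 1) + u + w k, p (k - 1) + w k}"
    using z k D by (simp add: convex_hull_para)
  from extreme_point_of_convex_hull[OF this] D(3) show ?thesis
    by (auto simp: k(2))
qed (simp add: cross_coord_def)

lemma cross_coord_agree:
  assumes s: "strip W E p u w" and T: "T \<in> \<T>" "T' \<in> \<T>" and z: "z \<in> T" "z \<in> T'"
  shows "cross_coord W p u w T z - cross_coord W p u w T' z \<in> \<int>"
proof (cases "T = T' \<or> z extreme_point_of T")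
  case True
  then have "T \<noteq> T' \<Longrightarrow> z extreme_point_of T \<and> z extreme_point_of T'"
    using vertex_in_tile[OF T _ z(2)] by blast
  then show ?thesis
    using cross_coord_vertex[OF s] by (cases "T = T'") (simp_all add: Ints_diff)
next
  case False
  then obtain e where e: "z \<in> e" "e edge_of T" "e edge_of T'"
    using common_edge[OF T _ z] by metis
  show ?thesis
  proof (cases "e \<in> range E")
    case True
    then obtain i where i: "e = E i" by blast
    with e(1) have "z \<in> side (p i) u"
      using stripD(1)[OF s, of i] by simp
    then obtain r where "z = p i + r *\<^sub>R u"
      unfolding mem_side by blast
    then show ?thesis
      using cross_coord_strip_edge(2)[OF s] T e i by simp
  next
    case False
    with cross_coord_other_edge[OF s] e show ?thesis by simp
  qed
qed

lemma continuous_on_cross_coord: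
  assumes s: "strip W E p u w"
  shows "continuous_on S (cross_coord W p u w T)"
proof (cases "T \<in> range W")
  case True
  then obtain k where "cross_coord W p u w T = (\<lambda>z. cross2 (z - p (k - 1)) (w k) / cross2 u (w k))"
    by (metis cross_coordE ext)
  then show ?thesis
    using strip_facts(3)[OF s, of k] by (auto intro!: continuous_intros)
next
  case False
  then have "cross_coord W p u w T = (\<lambda>z. 0)"
    by (auto simp: cross_coord_def)
  then show ?thesis by simp
qed

lemma locally_finite_nhds: "\<exists>V. open V \<and> x \<in> V \<and> finite {T \<in> \<T>. T \<inter> V \<noteq> {}}"
  using locally_finite unfolding locally_finite_tiling_def
  by (intro exI[of _ "ball x 1"]) simp

text \<open>Gluing the maps \<open>cis (2 * pi * cross_coord)\<close> gives a continuous map from the plane to the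
  circle; its logarithm exists because the plane is contractible.\<close>

lemma height_exists:
  assumes s: "strip W E p u w"
  obtains F :: "real^2 \<Rightarrow> real" where
    "\<And>T x y. \<lbrakk>T \<in> \<T>; x \<in> T; y \<in> T\<rbrakk> \<Longrightarrow>
       F y - F x = cross_coord W p u w T y - cross_coord W p u w T x"
proof -
  let ?h = "cross_coord W p u w"
  let ?f = "\<lambda>T z. exp (of_real (2 * pi * ?h T z) * \<i>)"
  have agree: "?f T z = ?f T' z" if TT': "T \<in> \<T>" "T' \<in> \<T>" "z \<in> T" "z \<in> T'" for T T' z
  proof -
    from cross_coord_agree[OF s TT'] obtain n where "?h T z - ?h T' z = of_int n"
      by (auto elim: Ints_cases)
    then have h: "?h T z = ?h T' z + of_int n" by simp
    show ?thesis
      unfolding exp_eq by (intro exI[of _ n]) (simp add: h algebra_simps)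
  qed
  obtain g where g: "continuous_map euclidean euclidean g"
    "\<And>x T. T \<in> \<T> \<Longrightarrow> x \<in> T \<Longrightarrow> g x = ?f T x"
  proof (rule pasting_lemma_exists_locally_finite[of euclidean \<T> "\<lambda>T. T" euclidean ?f
        "\<lambda>x. ?f (SOME T. T \<in> \<T> \<and> x \<in> T) x"])
    show "\<exists>V. openin euclidean V \<and> x \<in> V \<and> finite {T \<in> \<T>. T \<inter> V \<noteq> {}}" for x :: "real^2"
      using locally_finite_nhds by simp
    show "topspace euclidean \<subseteq> \<Union> ((\<lambda>T. T) ` \<T>)"
      using tiles_cover by auto
    show "closedin euclidean T" if "T \<in> \<T>" for T
      using parallelogramE[OF parallelogram_tile[OF that]] closed_para
      by (metis closed_closedin)
    show "continuous_map (subtopology euclidean T) euclidean (?f T)" if "T \<in> \<T>" for T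
      by (simp del: of_real_mult) (intro continuous_intros continuous_on_cross_coord[OF s])
    show "?f T x = ?f T' x" if "T \<in> \<T>" "T' \<in> \<T>" "x \<in> topspace euclidean \<inter> T \<inter> T'" for T T' x
      using agree that by blast
    show "\<exists>T. T \<in> \<T> \<and> x \<in> T \<and> ?f (SOME T. T \<in> \<T> \<and> x \<in> T) x = ?f T x" for x
      using someI_ex[of "\<lambda>T. T \<in> \<T> \<and> x \<in> T"] tiles_cover by blast
  qed (use that in auto)
  have "continuous_on UNIV g"
    using g(1) by simp
  moreover have "g z \<noteq> 0" for z
    using g(2) tiles_cover[of z] by auto
  ultimately obtain L where L: "continuous_on UNIV L" "\<And>z. g z = exp (L z)"
    using continuous_logarithm_on_contractible[of UNIV g] contractible_UNIV by (metis UNIV_I)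
  \<comment> \<open>Dividing by a full turn makes the ambiguity of the logarithm an integer.\<close>
  define F where "F z = Im (L z) / (2 * pi)" for z
  have F_int: "F z - ?h T z \<in> \<int>" if "T \<in> \<T>" "z \<in> T" for T z
  proof -
    have "exp (L z) = ?f T z"
      using g(2)[OF that] L(2) by simp
    then obtain n where "L z = of_real (2 * pi * ?h T z) * \<i> + (of_int (2 * n) * pi) * \<i>"
      unfolding exp_eq by blast
    then have "Im (L z) = 2 * pi * (?h T z + of_int n)"
      by (simp add: algebra_simps)
    then show ?thesis
      by (simp add: F_def)
  qed
  have "F y - F x = ?h T y - ?h T x" if T: "T \<in> \<T>" "x \<in> T" "y \<in> T" for T x y
  proof -
    let ?d = "\<lambda>z. F z - ?h T z"
    have "connected T"
      using parallelogramE[OF parallelogram_tile[OF T(1)]] convex_para convex_connected by metis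
    moreover have "continuous_on T ?d"
      unfolding F_def using continuous_on_subset[OF L(1)]
      by (intro continuous_intros continuous_on_cross_coord[OF s]) auto
    \<comment> \<open>Distinct integers are at least 1 apart, so a continuous integer-valued
      difference is constant on the connected tile.\<close>
    moreover have "\<exists>e>0. \<forall>b. b \<in> T \<and> ?d b \<noteq> ?d a \<longrightarrow> e \<le> norm (?d b - ?d a)" if "a \<in> T" for a
    proof (intro exI[of _ 1] conjI allI impI)
      fix b assume b: "b \<in> T \<and> ?d b \<noteq> ?d a"
      have "?d b - ?d a \<in> \<int>"
        using F_int[OF T(1)] b \<open>a \<in> T\<close> by (blast intro: Ints_diff)
      with b show "1 \<le> norm (?d b - ?d a)"
        using Ints_nonzero_abs_ge1[of "?d b - ?d a"] by simp
    qed simp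
    ultimately have "?d constant_on T"
      by (rule continuous_discrete_range_constant)
    with T have "?d y = ?d x"
      unfolding constant_on_def by metis
    then show ?thesis by simp
  qed
  then show ?thesis by (rule that)
qed

section \<open>Heights along a worm, and crossings of two worms\<close>

lemma strip_corners:
  assumes "strip W E p u w"
  shows "p (i - 1) \<in> W i" "p i \<in> W i" "p i + u \<in> W i"
proof -
  note nz = strip_facts(3)[OF assms, of i]
  show "p (i - 1) \<in> W i"
    unfolding stripD(2)[OF assms, of i]
    using side_endpoints_extreme(1)[OF nz] by (simp add: extreme_point_of_def)
  have "cross2 u (- w i) \<noteq> 0" using nz by simp
  from side_endpoints_extreme[OF this, of "p i"] show "p i \<in> W i" "p i + u \<in> W i"
    unfolding strip_facts(2)[OF assms, of i] by (simp_all add: extreme_point_of_def)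
qed

lemma height_along_strip:
  assumes s: "strip W E p u w"
    and F: "\<And>T x y. \<lbrakk>T \<in> \<T>; x \<in> T; y \<in> T\<rbrakk> \<Longrightarrow>
       F y - F x = cross_coord W p u w T y - cross_coord W p u w T x"
  shows "F (p i) = F (p 0)" "F (p i + u) = F (p 0) + (1 :: real)"
proof -
  note D = strip_facts(1)[OF s]
  have e: "E i edge_of W i" "E (i - 1) edge_of W i" for i
    using strip_links[OF s] links_pred(2)[OF strip_links[OF s]] unfolding links_def by blast+
  have h: "cross_coord W p u w (W i) (p i + r *\<^sub>R u) = r"
    "cross_coord W p u w (W i) (p (i - 1) + r *\<^sub>R u) = r" for i r
    using cross_coord_strip_edge(2)[OF s D] e by blast+
  have step: "F (p i) = F (p (i - 1))" for i
    using F[OF D[of i], of "p (i - 1)" "p i"] strip_corners[OF s, of i] h[of i 0] by simp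
  show *: "F (p i) = F (p 0)"
  proof (induction i rule: int_induct[where k = 0])
    case (step1 i)
    with step[of "i + 1"] show ?case by simp
  next
    case (step2 i)
    with step[of i] show ?case by simp
  qed simp
  show "F (p i + u) = F (p 0) + 1"
    using F[OF D[of i], of "p i" "p i + u"] strip_corners[OF s, of i] h(1)[of i 0] h(1)[of i 1] *
    by simp
qed

text \<open>The tile has only two edge directions. As \<open>u'\<close> is not parallel to
  \<open>u\<close>, it is plus or minus \<open>w i\<close>, which leaves plus or minus
  \<open>u\<close> for \<open>w' j\<close>: the second worm passes along a full edge of the first,
  from one boundary line to the other.\<close>

lemma crossing_tile:
  assumes s: "strip W E p u w" and s': "strip W' E' p' u' w'" and nz: "cross2 u u' \<noteq> 0"
    and eq: "W' j = W i"
  shows "\<exists>m. w' j = u \<and> p' (j - 1) = p m \<and> p' j = p m + u \<or>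
             w' j = - u \<and> p' (j - 1) = p m + u \<and> p' j = p m"
proof -
  note D = stripD(2,3)[OF s, of i] strip_facts(3)[OF s, of i]
    and D' = stripD(2,3)[OF s', of j] strip_facts(3)[OF s', of j]
  have T: "para (p (i - 1)) u (w i) = para (p' (j - 1)) u' (w' j)"
    using D(1) D'(1) eq by simp
  have w'u': "cross2 (w' j) u' \<noteq> 0"
    using D'(3) cross2_commute[of "w' j" u'] by simp
  have "side (p' (j - 1)) u' edge_of para (p (i - 1)) u (w i)"
    unfolding T by (rule side_edge_of_para[OF D'(3)])
  from nonparallel_edge_of_para[OF D(3) this nz] have u': "u' = w i \<or> u' = - w i"
    by (auto simp: side_eq_iff)
  have e: "side (p' (j - 1)) (w' j) edge_of para (p (i - 1)) u (w i)"
    unfolding T para_swap[of "p' (j - 1)" u'] by (rule side_edge_of_para[OF w'u'])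
  have "cross2 u (w' j) = 0"
  proof (rule ccontr)
    assume "cross2 u (w' j) \<noteq> 0"
    from nonparallel_edge_of_para[OF D(3) e this] have "w' j = w i \<or> w' j = - w i"
      by (auto simp: side_eq_iff)
    with u' w'u' show False by auto
  qed
  from parallel_edge_of_para[OF D(3) e this]
  obtain m where "side (p' (j - 1)) (w' j) = side (p m) u"
    using D(2) by metis
  then have "p' (j - 1) = p m \<and> w' j = u \<or> p m = p' (j - 1) + w' j \<and> u = - w' j"
    unfolding side_eq_iff .
  then show ?thesis
    using D'(2) by (intro exI[of _ m]) auto
qed

lemma no_second_crossing_directed:
  assumes s: "strip W E p u w" and s': "strip W' E' p' u' w'" and nz: "cross2 u u' \<noteq> 0"
    and eq: "W' j = W i" "W' l = W k" and less: "j < l" and dir: "w' j = u"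
  shows False
proof -
  obtain F :: "real^2 \<Rightarrow> real" where F: "\<And>T x y. \<lbrakk>T \<in> \<T>; x \<in> T; y \<in> T\<rbrakk> \<Longrightarrow>
       F y - F x = cross_coord W p u w T y - cross_coord W p u w T x"
    using height_exists[OF s] by blast
  note along = height_along_strip[OF s F]
  have cross: "F (p' (n - 1)) = F (p 0) \<and> F (p' n) = F (p 0) + 1" if n: "W' n \<in> range W" for n
  proof -
    from n obtain i where "W' n = W i" by blast
    from crossing_tile[OF s s' nz this] obtain m where
      m: "w' n = u \<and> p' (n - 1) = p m \<and> p' n = p m + u \<or>
          w' n = - u \<and> p' (n - 1) = p m + u \<and> p' n = p m" by blast
    \<comment> \<open>The fixed sign along \<open>W'\<close> carries the direction of crossing from
      position \<open>j\<close> to every other position.\<close>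
    have "cross2 u' (w' j) * cross2 u' (w' n) > 0"
      by (rule stripD(4)[OF s'])
    then have "w' n \<noteq> - u"
      unfolding dir by (auto simp: zero_less_mult_iff)
    with m along show ?thesis by auto
  qed
  have mono: "F (p' (n - 1)) \<le> F (p' n)" for n
  proof (cases "W' n \<in> range W")
    case True
    from cross[OF this] show ?thesis by simp
  next
    case False
    then show ?thesis
      using F[OF strip_facts(1)[OF s', of n], of "p' (n - 1)" "p' n"] strip_corners[OF s', of n]
      by (simp add: cross_coord_def)
  qed
  \<comment> \<open>\<open>p' j\<close> is the exit corner of the first crossing and
    \<open>p' (l - 1)\<close> the entry corner of the second, so the left value is in fact larger by
    1.\<close>
  have "F (p' j) \<le> F (p' (l - 1))"
  proof -
    have "F (p' j) \<le> F (p' n)" if "j \<le> n" for n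
      using that
    proof (induction n rule: int_ge_induct)
      case (step n)
      with mono[of "n + 1"] show ?case by simp
    qed simp
    then show ?thesis using less by simp
  qed
  moreover have "W' j \<in> range W" "W' l \<in> range W"
    using eq by simp_all
  ultimately show False
    using cross by fastforce
qed

lemma no_second_crossing:
  assumes s: "strip W E p u w" and s': "strip W' E' p' u' w'" and nz: "cross2 u u' \<noteq> 0"
    and eq: "W' j = W i" "W' l = W k" and less: "j < l"
  shows False
proof (cases "w' j = u")
  case True
  then show ?thesis
    using no_second_crossing_directed[OF s s' nz eq less] by simp
next
  case False
  then have "w' j = - u"
    using crossing_tile[OF s s' nz eq(1)] by blast
  then show ?thesis
    using no_second_crossing_directed[OF strip_flip[OF s] s' _ eq less] nz by simp
qed

lemma worms_cross_at_most_once: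
  assumes W: "worm \<T> W" "worm \<T> W'" and ne: "\<not> same_worm W W'"
    and T: "T \<in> worm_inter W W'" "T' \<in> worm_inter W W'"
  shows "T = T'"
proof (rule ccontr)
  assume TT': "T \<noteq> T'"
  obtain E E' where l: "links W E" "links W' E'"
    using W worm_links by blast
  obtain p u w where s: "strip W E p u w"
    using strip_exists[OF l(1)] by blast
  obtain p' u' w' where s': "strip W' E' p' u' w'"
    using strip_exists[OF l(2)] by blast
  obtain i j where ij: "W i = T" "W' j = T"
    using T(1) unfolding worm_inter_def by auto
  obtain k m where km: "W k = T'" "W' m = T'"
    using T(2) unfolding worm_inter_def by auto
  \<comment> \<open>Parallel worms through the common tile \<open>T\<close> would coincide, so these
    two are transverse.\<close>
  have nz: "cross2 u u' \<noteq> 0"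
    using same_worm_if_parallel[OF l, of j i] stripD(1)[OF s, of i] stripD(1)[OF s', of j] ij ne
    by metis
  have "j \<noteq> m" using TT' ij km by auto
  then consider "j < m" | "m < j" by linarith
  then show False
    by cases (use no_second_crossing[OF s s' nz] ij km in metis)+
qed

lemma parallel_worms_disjoint:
  assumes W: "W \<in> worm_family \<T> e" "W' \<in> worm_family \<T> e" and T: "T \<in> \<T>" "e edge_of T"
    and ne: "\<not> same_worm W W'"
  shows "worm_inter W W' = {}"
proof (rule ccontr)
  assume "worm_inter W W' \<noteq> {}"
  then obtain i j where ij: "W' j = W i"
    unfolding worm_inter_def by auto
  obtain E where l: "links W E" "parallel_edges e (E 0)"
    using W worm_family_links by blast
  obtain E' where l': "links W' E'" "parallel_edges e (E' 0)"
    using W worm_family_links by blast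
  obtain p u w where s: "strip W E p u w"
    using strip_exists[OF l(1)] by blast
  obtain p' u' w' where s': "strip W' E' p' u' w'"
    using strip_exists[OF l'(1)] by blast
  obtain P q v where e: "e = side P q" "cross2 q v \<noteq> 0"
    using edge_of_tileE parallelogram_tile T by metis
  then have "q \<noteq> 0" by auto
  \<comment> \<open>The worms are compared through the nonzero direction of \<open>e\<close>, as
    only their edges at index 0 are known to be parallel to it; the strip form spreads this to all
    edges.\<close>
  moreover have "cross2 q u = 0" "cross2 q u' = 0"
    using l(2) l'(2) parallel_edges_side e stripD(1)[OF s, of 0] stripD(1)[OF s', of 0] by metis+
  ultimately have "cross2 u u' = 0"
    by (rule cross2_eq_0_trans)
  then show False
    using same_worm_if_parallel[OF l(1) l'(1) ij] stripD(1)[OF s, of i] stripD(1)[OF s', of j] ne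
    by metis
qed

end

theorem lemma2p3:
  fixes \<T> :: "(real^2) set set"
  assumes "parallelogram_tiling \<T>"
    and "locally_finite_tiling \<T>"
    and "vertex_to_vertex \<T>"
  shows "(\<forall>W W'. worm \<T> W \<and> worm \<T> W' \<and> \<not> same_worm W W' \<longrightarrow>
            worm_inter W W' = {} \<or> (\<exists>T. worm_inter W W' = {T})) \<and>
         (\<forall>T e W W'. T \<in> \<T> \<and> e edge_of T \<and>
            W \<in> worm_family \<T> e \<and> W' \<in> worm_family \<T> e \<and> \<not> same_worm W W' \<longrightarrow>
            worm_inter W W' = {})"
proof -
  interpret v2v_tiling \<T>
    by unfold_locales (fact assms)+
  show ?thesis
  proof (intro conjI allI impI; (elim conjE)?)
    fix W W' assume "worm \<T> W" "worm \<T> W'" "\<not> same_worm W W'"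
    from worms_cross_at_most_once[OF this] show "worm_inter W W' = {} \<or> (\<exists>T. worm_inter W W' = {T})"
      by blast
  next
    fix T e W W'
    assume "T \<in> \<T>" "e edge_of T" "W \<in> worm_family \<T> e" "W' \<in> worm_family \<T> e" "\<not> same_worm W W'"
    then show "worm_inter W W' = {}"
      by (intro parallel_worms_disjoint)
  qed
qed

end
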